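(* Let $G$ and $G'$ be finite groups. A matrix $U\in\mathbb{C}^{G\times G'}$ is the transformation matrix of a $(G,G')$-invariant quantum Latin square if and only if (1) $U$ is unitary; (2) $\overline{U_{a,b}}=U_{a^{-1},b^{-1}}$ for all $a\in G$, $b\in G'$; and (3) $U_{ab,c}=\sum_{x,y\in G',\ xy=c}U_{a,x}U_{b,y}$ for all $a,b\in G$ and $c\in G'$.
   Context: $\mathbb{C}^{G\times G'}$ is the set of complex matrices with rows indexed by $G$ and columns indexed by $G'$; a unitary matrix is in particular square ($|G|=|G'|$). A quantum Latin square is an $n\times n$ array $\Psi=(|\psi_{i,j}\rangle)$ of vectors from an $n$-dimensional complex inner product space $V$ such that the entries of each row and of each column form an orthonormal basis of $V$. Inner products $\langle\cdot|\cdot\rangle$ are conjugate-linear in the first argument. A quantum Latin square $\Psi=(|\psi_{a,b}\rangle)$ is $(G,G')$-invariant if its rows are indexed by $G$ and its columns by $G'$ and the inner product $\langle\psi_{a,b}|\psi_{c,d}\rangle$ depends only on the values of $a^{-1}c\in G$ and $b^{-1}d\in G'$. Its transformation matrix is the $G\times G'$ matrix $U^\Psi$ with $U^\Psi_{x,y}=\langle\psi_{a,b}|\psi_{c,d}\rangle$ for any $a,c\in G$, $b,d\in G'$ with $a^{-1}c=x$ and $b^{-1}d=y$. *)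

theory Defs
  imports Complex_Main "HOL-Algebra.Group" "HOL-Library.Poly_Mapping"
begin

section \<open>Complex inner product spaces\<close>

locale complex_inner_product_space = vector_space scale
  for scale :: "complex \<Rightarrow> 'v::ab_group_add \<Rightarrow> 'v" +
  fixes cinner :: "'v \<Rightarrow> 'v \<Rightarrow> complex"
  assumes cinner_add_right: "cinner u (v + w) = cinner u v + cinner u w"
    and cinner_scale_right: "cinner u (scale c v) = c * cinner u v"
    and cinner_commute: "cinner v u = cnj (cinner u v)"
    and cinner_ge_zero: "0 \<le> Re (cinner v v)"
    and cinner_eq_zero_iff: "cinner v v = 0 \<longleftrightarrow> v = 0"
begin

text \<open>Bases are indexed families, so that an orthonormal family has no repetitions. The space
  \<open>V\<close> spanned by them is a subspace of the ambient space, which may be larger, and which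
  may also coincide with \<open>V\<close>.\<close>

definition orthonormal_basis :: "'v set \<Rightarrow> 'i set \<Rightarrow> ('i \<Rightarrow> 'v) \<Rightarrow> bool" where
  "orthonormal_basis V I f \<longleftrightarrow>
     (\<forall>i\<in>I. \<forall>j\<in>I. cinner (f i) (f j) = (if i = j then 1 else 0)) \<and>
     independent (f ` I) \<and> span (f ` I) = V"

section \<open>Quantum Latin squares\<close>

text \<open>The clause on \<open>B\<close> says that \<open>V\<close> is a finite-dimensional subspace; it is needed
  because \<^term>\<open>dim\<close> is 0 on infinite-dimensional subspaces.\<close>

definition quantum_latin_square ::
    "'v set \<Rightarrow> 'i set \<Rightarrow> 'j set \<Rightarrow> ('i \<Rightarrow> 'j \<Rightarrow> 'v) \<Rightarrow> bool" where
  "quantum_latin_square V I J \<Psi> \<longleftrightarrow>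
     (\<exists>B. finite B \<and> span B = V) \<and>
     finite I \<and> finite J \<and> card I = dim V \<and> card J = dim V \<and>
     (\<forall>i\<in>I. orthonormal_basis V J (\<lambda>j. \<Psi> i j)) \<and>
     (\<forall>j\<in>J. orthonormal_basis V I (\<lambda>i. \<Psi> i j))"

definition invariant_quantum_latin_square ::
    "'v set \<Rightarrow> ('a, 'm) monoid_scheme \<Rightarrow> ('b, 'n) monoid_scheme \<Rightarrow> ('a \<Rightarrow> 'b \<Rightarrow> 'v) \<Rightarrow> bool" where
  "invariant_quantum_latin_square V G G' \<Psi> \<longleftrightarrow>
     quantum_latin_square V (carrier G) (carrier G') \<Psi> \<and>
     (\<forall>a\<in>carrier G. \<forall>c\<in>carrier G. \<forall>b\<in>carrier G'. \<forall>d\<in>carrier G'.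
      \<forall>a'\<in>carrier G. \<forall>c'\<in>carrier G. \<forall>b'\<in>carrier G'. \<forall>d'\<in>carrier G'.
        inv\<^bsub>G\<^esub> a \<otimes>\<^bsub>G\<^esub> c = inv\<^bsub>G\<^esub> a' \<otimes>\<^bsub>G\<^esub> c' \<longrightarrow>
        inv\<^bsub>G'\<^esub> b \<otimes>\<^bsub>G'\<^esub> d = inv\<^bsub>G'\<^esub> b' \<otimes>\<^bsub>G'\<^esub> d' \<longrightarrow>
        cinner (\<Psi> a b) (\<Psi> c d) = cinner (\<Psi> a' b') (\<Psi> c' d'))"

text \<open>A matrix with rows indexed by \<open>G\<close> and columns by \<open>G'\<close> is a function of two arguments
  of which only the values on the carriers matter.\<close>

definition transformation_matrix ::
    "('a, 'm) monoid_scheme \<Rightarrow> ('b, 'n) monoid_scheme \<Rightarrow> ('a \<Rightarrow> 'b \<Rightarrow> 'v) \<Rightarrow>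
     ('a \<Rightarrow> 'b \<Rightarrow> complex) \<Rightarrow> bool" where
  "transformation_matrix G G' \<Psi> U \<longleftrightarrow>
     (\<forall>x\<in>carrier G. \<forall>y\<in>carrier G'.
      \<forall>a\<in>carrier G. \<forall>c\<in>carrier G. \<forall>b\<in>carrier G'. \<forall>d\<in>carrier G'.
        inv\<^bsub>G\<^esub> a \<otimes>\<^bsub>G\<^esub> c = x \<longrightarrow> inv\<^bsub>G'\<^esub> b \<otimes>\<^bsub>G'\<^esub> d = y \<longrightarrow>
        U x y = cinner (\<Psi> a b) (\<Psi> c d))"

end

text \<open>The type argument is the ambient type of the vectors: a definition cannot quantify over
  types. The vector space structure, the inner product and the subspace \<open>V\<close> are arbitrary.\<close>

definition is_transformation_matrix ::
    "'v::ab_group_add itself \<Rightarrow> ('a, 'm) monoid_scheme \<Rightarrow> ('b, 'n) monoid_scheme \<Rightarrow>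
     ('a \<Rightarrow> 'b \<Rightarrow> complex) \<Rightarrow> bool" where
  "is_transformation_matrix (_ :: 'v itself) G G' U \<longleftrightarrow>
     (\<exists>(scale :: complex \<Rightarrow> 'v \<Rightarrow> 'v) cinner V \<Psi>.
        complex_inner_product_space scale cinner \<and>
        complex_inner_product_space.invariant_quantum_latin_square scale cinner V G G' \<Psi> \<and>
        complex_inner_product_space.transformation_matrix cinner G G' \<Psi> U)"

section \<open>Unitary matrices\<close>

definition unitary_matrix :: "'i set \<Rightarrow> 'j set \<Rightarrow> ('i \<Rightarrow> 'j \<Rightarrow> complex) \<Rightarrow> bool" where
  "unitary_matrix I J U \<longleftrightarrow>
     card I = card J \<and>
     (\<forall>i\<in>I. \<forall>k\<in>I. (\<Sum>j\<in>J. U i j * cnj (U k j)) = (if i = k then 1 else 0)) \<and>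
     (\<forall>j\<in>J. \<forall>l\<in>J. (\<Sum>i\<in>I. cnj (U i j) * U i l) = (if j = l then 1 else 0))"

end

theory Submission
  imports Defs
begin

text \<open>If \<open>U\<close> comes from \<open>\<Psi>\<close>, then \<open>\<langle>\<psi>\<^sub>a\<^sub>,\<^sub>b|\<psi>\<^sub>c\<^sub>,\<^sub>d\<rangle> = U (a\<inverse>c) (b\<inverse>d)\<close>, and (1) and (3) are Parseval's
  identity for the row or the column of \<open>\<Psi>\<close> at the identity element. Conversely, expanding
  \<open>\<psi>\<^sub>a\<^sub>,\<^sub>b\<close> in the row at the identity forces \<open>\<psi>\<^sub>a\<^sub>,\<^sub>b\<close> to have coordinates \<open>U a (x\<inverse>b)\<close>, \<open>x \<in> G'\<close>.
  By (2) and (3) these vectors have the right inner products, so that the rows and columns are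
  orthonormal because \<open>U 1 y = \<delta>\<^sub>y\<^sub>,\<^sub>1\<close> and \<open>U x 1 = \<delta>\<^sub>x\<^sub>,\<^sub>1\<close>; both follow from (1)--(3).\<close>

section \<open>Convolution over a group and reindexing of sums\<close>

text \<open>Reading the row \<open>U a\<close> as the element of the group algebra of
  \<open>G'\<close> with these coefficients, this says that \<open>a \<mapsto> U a\<close> turns
  products in \<open>G\<close> into products in that algebra.\<close>

definition convolution_property ::
    "('a, 'm) monoid_scheme \<Rightarrow> ('b, 'n) monoid_scheme \<Rightarrow> ('a \<Rightarrow> 'b \<Rightarrow> complex) \<Rightarrow> bool" where
  "convolution_property G G' U \<longleftrightarrow>
     (\<forall>a\<in>carrier G. \<forall>b\<in>carrier G. \<forall>c\<in>carrier G'.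
        U (a \<otimes>\<^bsub>G\<^esub> b) c =
        (\<Sum>(x, y)\<in>{(x, y). x \<in> carrier G' \<and> y \<in> carrier G' \<and> x \<otimes>\<^bsub>G'\<^esub> y = c}. U a x * U b y))"

text \<open>The second factor is determined by the first, which reduces a sum over pairs to one over
  the group.\<close>

lemma (in group) sum_factorizations:
  fixes h :: "'a \<Rightarrow> 'a \<Rightarrow> 'c::comm_monoid_add"
  assumes "c \<in> carrier G"
  shows "(\<Sum>(x, y)\<in>{(x, y). x \<in> carrier G \<and> y \<in> carrier G \<and> x \<otimes> y = c}. h x y) =
         (\<Sum>x\<in>carrier G. h x (inv x \<otimes> c))"
  by (rule sum.reindex_bij_witness[where i = "\<lambda>x. (x, inv x \<otimes> c)" and j = fst])
     (use assms in \<open>auto simp: m_assoc[symmetric]\<close>)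

lemma (in group) sum_left_mult:
  fixes h :: "'a \<Rightarrow> 'c::comm_monoid_add"
  assumes "b \<in> carrier G"
  shows "(\<Sum>x\<in>carrier G. h (b \<otimes> x)) = (\<Sum>x\<in>carrier G. h x)"
  by (rule sum.reindex_bij_witness[where i = "\<lambda>x. inv b \<otimes> x" and j = "\<lambda>x. b \<otimes> x"])
     (use assms in \<open>auto simp: m_assoc[symmetric]\<close>)

lemma (in group) sum_inv_mult:
  fixes h :: "'a \<Rightarrow> 'c::comm_monoid_add"
  assumes "b \<in> carrier G"
  shows "(\<Sum>x\<in>carrier G. h (inv x \<otimes> b)) = (\<Sum>x\<in>carrier G. h x)"
  by (rule sum.reindex_bij_witness[where i = "\<lambda>x. b \<otimes> inv x" and j = "\<lambda>x. inv x \<otimes> b"])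
     (use assms in \<open>auto simp: m_assoc inv_mult_group, auto simp: m_assoc[symmetric]\<close>)

lemma (in group) inv_mult_eq_one_iff:
  assumes "x \<in> carrier G" "y \<in> carrier G"
  shows "inv x \<otimes> y = \<one> \<longleftrightarrow> x = y"
  using assms by (metis inv_closed inv_inv inv_equality l_inv)

section \<open>Orthonormal families and Parseval's identity\<close>

context complex_inner_product_space
begin

lemma cinner_zero_right [simp]: "cinner u 0 = 0"
  using cinner_scale_right[of u 0 0] by simp

lemma cinner_sum_right: "cinner u (\<Sum>i\<in>I. f i) = (\<Sum>i\<in>I. cinner u (f i))"
  by (induction I rule: infinite_finite_induct) (auto simp: cinner_add_right)

text \<open>The metric clause of \<open>orthonormal_basis\<close> on its own;
  \<open>orthonormal_basisI\<close> recovers the clauses on independence and span by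
  counting.\<close>

definition orthonormal_family :: "'i set \<Rightarrow> ('i \<Rightarrow> 'v) \<Rightarrow> bool" where
  "orthonormal_family I f \<longleftrightarrow>
     (\<forall>i\<in>I. \<forall>j\<in>I. cinner (f i) (f j) = (if i = j then 1 else 0))"

lemma orthonormal_family_inj_on:
  assumes "orthonormal_family I f"
  shows "inj_on f I"
  using assms unfolding orthonormal_family_def inj_on_def by (metis zero_neq_one)

text \<open>Pairing a vanishing linear combination with one of its vectors leaves only the
  coefficient of that vector.\<close>

lemma orthonormal_family_independent:
  assumes "orthonormal_family I f"
  shows "independent (f ` I)"
  unfolding independent_explicit_module
proof (intro allI impI)
  fix t u v
  assume t: "finite t" "t \<subseteq> f ` I" "(\<Sum>w\<in>t. scale (u w) w) = 0" "v \<in> t"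
  \<comment> \<open>The elements of \<open>t\<close> are vectors, not indices; distinct indices give
    distinct vectors, since otherwise 0 = 1.\<close>
  have ip: "cinner v w = (if w = v then 1 else 0)" if "w \<in> t" for w
    using assms t(2,4) that unfolding orthonormal_family_def
    by (smt (verit, best) image_iff subsetD)
  have "0 = cinner v (\<Sum>w\<in>t. scale (u w) w)" using t by simp
  also have "\<dots> = (\<Sum>w\<in>t. if w = v then u w else 0)"
    by (auto simp: cinner_sum_right cinner_scale_right ip intro!: sum.cong)
  finally show "u v = 0" using t by (simp add: sum.delta)
qed

text \<open>If some \<open>v\<close> in \<open>V\<close> lay outside the span of the family,
  adjoining it would give \<open>dim V + 1\<close> independent vectors inside
  \<open>V\<close>.\<close>

lemma orthonormal_basisI:
  assumes f: "orthonormal_family I f" "f ` I \<subseteq> V" "card I = dim V"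
    and V: "finite B" "span B = V"
  shows "orthonormal_basis V I f"
proof -
  have ind: "independent (f ` I)" using f by (simp add: orthonormal_family_independent)
  obtain C where C: "C \<subseteq> V" "independent C" "V \<subseteq> span C" "card C = dim V"
    using basis_exists[of V] by blast
  \<comment> \<open>The finite spanning set \<open>B\<close> bounds the basis \<open>C\<close>; only
    for finite \<open>C\<close> does \<open>card C\<close> limit the size of independent
    sets.\<close>
  have "finite C" using independent_span_bound[of B C] C V by blast
  have "v \<in> span (f ` I)" if "v \<in> V" for v
  proof (rule ccontr)
    assume v: "v \<notin> span (f ` I)"
    then have "independent (insert v (f ` I))"
      by (simp add: ind independent_insert)
    moreover have "insert v (f ` I) \<subseteq> span C" using that f C by blast
    ultimately have "finite (insert v (f ` I)) \<and> card (insert v (f ` I)) \<le> card C"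
      by (rule independent_span_bound[OF \<open>finite C\<close>])
    then have fin: "finite (insert v (f ` I))"
      and le: "card (insert v (f ` I)) \<le> card C"
      by simp_all
    have "v \<notin> f ` I" using v span_base by blast
    then have "card (insert v (f ` I)) = Suc (card I)"
      using fin orthonormal_family_inj_on[OF f(1)] by (simp add: card_image)
    then show False using le C f by simp
  qed
  moreover have "span (f ` I) \<subseteq> V"
    using f(2) V(2) by (metis span_minimal subspace_span)
  ultimately show ?thesis
    using f(1) ind unfolding orthonormal_basis_def orthonormal_family_def by blast
qed

text \<open>Both sides are linear in \<open>v\<close>, so it is enough to compare them on the basis
  vectors.\<close>

lemma parseval:
  assumes f: "orthonormal_basis V I f" and "finite I" and "v \<in> V"
  shows "cinner u v = (\<Sum>i\<in>I. cinner u (f i) * cinner (f i) v)"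
proof -
  have "v \<in> span (f ` I)" using assms by (simp add: orthonormal_basis_def)
  then show ?thesis
  proof (induction rule: span_induct)
    \<comment> \<open>The claim here is that the vectors satisfying the identity form a
      subspace.\<close>
    case base
    show ?case
      by (auto simp: subspace_def cinner_add_right cinner_scale_right algebra_simps
          sum.distrib sum_distrib_left)
  next
    case (step w)
    then obtain k where k: "k \<in> I" "w = f k" by blast
    have "(\<Sum>i\<in>I. cinner u (f i) * cinner (f i) w) =
          (\<Sum>i\<in>I. if i = k then cinner u (f i) else 0)"
      using f k by (intro sum.cong) (auto simp: orthonormal_basis_def)
    then show ?case using k \<open>finite I\<close> by (simp add: sum.delta)
  qed
qed

section \<open>Necessity of the three conditions\<close>

lemma transformation_matrix_properties:
  fixes G :: "('a, 'm) monoid_scheme" and G' :: "('b, 'n) monoid_scheme"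
  assumes "group G" and "group G'"
    and inv: "invariant_quantum_latin_square V G G' \<Psi>"
    and tm: "transformation_matrix G G' \<Psi> U"
  shows "unitary_matrix (carrier G) (carrier G') U"
    and "\<forall>a\<in>carrier G. \<forall>b\<in>carrier G'. cnj (U a b) = U (inv\<^bsub>G\<^esub> a) (inv\<^bsub>G'\<^esub> b)"
    and "convolution_property G G' U"
proof -
  interpret G: group G by fact
  interpret H: group G' by fact
  have qls: "quantum_latin_square V (carrier G) (carrier G') \<Psi>"
    using inv by (simp add: invariant_quantum_latin_square_def)
  then have fin: "finite (carrier G)" "finite (carrier G')"
    and card: "card (carrier G) = card (carrier G')"
    by (auto simp: quantum_latin_square_def)
  have row: "orthonormal_basis V (carrier G') (\<lambda>j. \<Psi> i j)" if "i \<in> carrier G" for i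
    using qls that by (auto simp: quantum_latin_square_def)
  have col: "orthonormal_basis V (carrier G) (\<lambda>i. \<Psi> i j)" if "j \<in> carrier G'" for j
    using qls that by (auto simp: quantum_latin_square_def)
  have inV: "\<Psi> i j \<in> V" if "i \<in> carrier G" "j \<in> carrier G'" for i j
    using row[OF that(1)] that(2) by (auto simp: orthonormal_basis_def intro: span_base)
  have U: "cinner (\<Psi> a b) (\<Psi> c d) = U (inv\<^bsub>G\<^esub> a \<otimes>\<^bsub>G\<^esub> c) (inv\<^bsub>G'\<^esub> b \<otimes>\<^bsub>G'\<^esub> d)"
    if "a \<in> carrier G" "c \<in> carrier G" "b \<in> carrier G'" "d \<in> carrier G'" for a b c d
    using tm that unfolding transformation_matrix_def by simp
  \<comment> \<open>The row of \<open>\<Psi>\<close> at the identity serves as basis. Starting from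
    row \<open>inv i\<close> makes the first factor \<open>U i j\<close>, and conjugate symmetry
    makes the second \<open>cnj (U k j)\<close>; the result pairs two entries of one column.\<close>
  have row_prod: "(\<Sum>j\<in>carrier G'. U i j * cnj (U k j)) = (if i = k then 1 else 0)"
    if "i \<in> carrier G" "k \<in> carrier G" for i k
  proof -
    have "(\<Sum>j\<in>carrier G'. U i j * cnj (U k j)) =
      (\<Sum>j\<in>carrier G'. cinner (\<Psi> (inv\<^bsub>G\<^esub> i) \<one>\<^bsub>G'\<^esub>) (\<Psi> \<one>\<^bsub>G\<^esub> j) *
         cinner (\<Psi> \<one>\<^bsub>G\<^esub> j) (\<Psi> (inv\<^bsub>G\<^esub> k) \<one>\<^bsub>G'\<^esub>))"
    proof (intro sum.cong refl)
      fix j assume j: "j \<in> carrier G'"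
      show "U i j * cnj (U k j) = cinner (\<Psi> (inv\<^bsub>G\<^esub> i) \<one>\<^bsub>G'\<^esub>) (\<Psi> \<one>\<^bsub>G\<^esub> j) *
         cinner (\<Psi> \<one>\<^bsub>G\<^esub> j) (\<Psi> (inv\<^bsub>G\<^esub> k) \<one>\<^bsub>G'\<^esub>)"
        using that j
        by (subst cinner_commute[where v = "\<Psi> \<one>\<^bsub>G\<^esub> j"]) (simp add: U)
    qed
    also have "\<dots> = cinner (\<Psi> (inv\<^bsub>G\<^esub> i) \<one>\<^bsub>G'\<^esub>) (\<Psi> (inv\<^bsub>G\<^esub> k) \<one>\<^bsub>G'\<^esub>)"
      using that fin by (intro parseval[symmetric, OF row] inV) auto
    also have "\<dots> = (if inv\<^bsub>G\<^esub> i = inv\<^bsub>G\<^esub> k then 1 else 0)"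
      using col[of "\<one>\<^bsub>G'\<^esub>"] that unfolding orthonormal_basis_def by simp
    finally show ?thesis using that by (metis G.inv_inv)
  qed
  \<comment> \<open>The same with the column at the identity as basis. As the conjugated entry
    belongs to \<open>j\<close>, the index \<open>l\<close> goes with the left vector.\<close>
  have col_prod: "(\<Sum>i\<in>carrier G. cnj (U i j) * U i l) = (if j = l then 1 else 0)"
    if "j \<in> carrier G'" "l \<in> carrier G'" for j l
  proof -
    have "(\<Sum>i\<in>carrier G. cnj (U i j) * U i l) =
      (\<Sum>i\<in>carrier G. cinner (\<Psi> \<one>\<^bsub>G\<^esub> (inv\<^bsub>G'\<^esub> l)) (\<Psi> i \<one>\<^bsub>G'\<^esub>) *
         cinner (\<Psi> i \<one>\<^bsub>G'\<^esub>) (\<Psi> \<one>\<^bsub>G\<^esub> (inv\<^bsub>G'\<^esub> j)))"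
    proof (intro sum.cong refl)
      fix i assume i: "i \<in> carrier G"
      show "cnj (U i j) * U i l = cinner (\<Psi> \<one>\<^bsub>G\<^esub> (inv\<^bsub>G'\<^esub> l)) (\<Psi> i \<one>\<^bsub>G'\<^esub>) *
         cinner (\<Psi> i \<one>\<^bsub>G'\<^esub>) (\<Psi> \<one>\<^bsub>G\<^esub> (inv\<^bsub>G'\<^esub> j))"
        using that i
        by (subst cinner_commute[where v = "\<Psi> i \<one>\<^bsub>G'\<^esub>"]) (simp add: U)
    qed
    also have "\<dots> = cinner (\<Psi> \<one>\<^bsub>G\<^esub> (inv\<^bsub>G'\<^esub> l)) (\<Psi> \<one>\<^bsub>G\<^esub> (inv\<^bsub>G'\<^esub> j))"
      using that fin by (intro parseval[symmetric, OF col] inV) auto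
    also have "\<dots> = (if inv\<^bsub>G'\<^esub> l = inv\<^bsub>G'\<^esub> j then 1 else 0)"
      using row[of "\<one>\<^bsub>G\<^esub>"] that unfolding orthonormal_basis_def by simp
    finally show ?thesis using that by (metis H.inv_inv)
  qed
  show "unitary_matrix (carrier G) (carrier G') U"
    using card row_prod col_prod by (simp add: unitary_matrix_def)
  show "\<forall>a\<in>carrier G. \<forall>b\<in>carrier G'. cnj (U a b) = U (inv\<^bsub>G\<^esub> a) (inv\<^bsub>G'\<^esub> b)"
  proof (intro ballI)
    fix a b assume ab: "a \<in> carrier G" "b \<in> carrier G'"
    \<comment> \<open>Exchanging the two vectors inverts both group differences, so (2) is conjugate
      symmetry.\<close>
    show "cnj (U a b) = U (inv\<^bsub>G\<^esub> a) (inv\<^bsub>G'\<^esub> b)"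
      using cinner_commute[of "\<Psi> a b" "\<Psi> \<one>\<^bsub>G\<^esub> \<one>\<^bsub>G'\<^esub>"] ab by (simp add: U)
  qed
  show "convolution_property G G' U"
    unfolding convolution_property_def
  proof (intro ballI)
    fix a b c assume abc: "a \<in> carrier G" "b \<in> carrier G" "c \<in> carrier G'"
    \<comment> \<open>The difference from \<open>inv a\<close> to \<open>b\<close> is
      \<open>a \<otimes> b\<close>, and expanding along the row at the identity splits it into
      \<open>a\<close> and \<open>b\<close>.\<close>
    have "U (a \<otimes>\<^bsub>G\<^esub> b) c = cinner (\<Psi> (inv\<^bsub>G\<^esub> a) \<one>\<^bsub>G'\<^esub>) (\<Psi> b c)"
      using abc by (simp add: U)
    also have "\<dots> = (\<Sum>x\<in>carrier G'. cinner (\<Psi> (inv\<^bsub>G\<^esub> a) \<one>\<^bsub>G'\<^esub>) (\<Psi> \<one>\<^bsub>G\<^esub> x) *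
        cinner (\<Psi> \<one>\<^bsub>G\<^esub> x) (\<Psi> b c))"
      using abc fin by (intro parseval[OF row] inV) auto
    also have "\<dots> = (\<Sum>x\<in>carrier G'. U a x * U b (inv\<^bsub>G'\<^esub> x \<otimes>\<^bsub>G'\<^esub> c))"
      using abc by (intro sum.cong) (auto simp: U)
    finally show "U (a \<otimes>\<^bsub>G\<^esub> b) c =
        (\<Sum>(x, y)\<in>{(x, y). x \<in> carrier G' \<and> y \<in> carrier G' \<and> x \<otimes>\<^bsub>G'\<^esub> y = c}. U a x * U b y)"
      using abc by (simp add: H.sum_factorizations)
  qed
qed

end

section \<open>The inner product space of finitely supported functions\<close>

abbreviation (input) lookup :: "('b \<Rightarrow>\<^sub>0 complex) \<Rightarrow> 'b \<Rightarrow> complex" where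
  "lookup \<equiv> Poly_Mapping.lookup"

abbreviation (input) keys :: "('b \<Rightarrow>\<^sub>0 complex) \<Rightarrow> 'b set" where
  "keys \<equiv> Poly_Mapping.keys"

definition poly_mapping_scale :: "complex \<Rightarrow> ('b \<Rightarrow>\<^sub>0 complex) \<Rightarrow> ('b \<Rightarrow>\<^sub>0 complex)" where
  "poly_mapping_scale c = Poly_Mapping.map ((*) c)"

text \<open>The standard inner product: terms outside the support of \<open>u\<close> vanish. Finite
  support keeps the sum finite even for infinite \<open>'b\<close>.\<close>

definition poly_mapping_cinner :: "('b \<Rightarrow>\<^sub>0 complex) \<Rightarrow> ('b \<Rightarrow>\<^sub>0 complex) \<Rightarrow> complex" where
  "poly_mapping_cinner u v = (\<Sum>x\<in>keys u. cnj (lookup u x) * lookup v x)"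

lemma lookup_poly_mapping_scale [simp]:
  "lookup (poly_mapping_scale c v) x = c * lookup v x"
  by (simp add: poly_mapping_scale_def Poly_Mapping.map.rep_eq when_def)

lemma poly_mapping_cinner_eq:
  assumes "finite A" "keys u \<subseteq> A"
  shows "poly_mapping_cinner u v = (\<Sum>x\<in>A. cnj (lookup u x) * lookup v x)"
  unfolding poly_mapping_cinner_def
  using assms by (intro sum.mono_neutral_left) (auto simp: in_keys_iff)

lemma complex_inner_product_space_poly_mapping:
  "complex_inner_product_space poly_mapping_scale
     (poly_mapping_cinner :: ('b \<Rightarrow>\<^sub>0 complex) \<Rightarrow> _)"
proof
  fix a b :: complex and x y :: "'b \<Rightarrow>\<^sub>0 complex"
  show "poly_mapping_scale a (x + y) = poly_mapping_scale a x + poly_mapping_scale a y"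
    "poly_mapping_scale (a + b) x = poly_mapping_scale a x + poly_mapping_scale b x"
    "poly_mapping_scale a (poly_mapping_scale b x) = poly_mapping_scale (a * b) x"
    "poly_mapping_scale 1 x = x"
    by (auto intro!: poly_mapping_eqI simp: lookup_add algebra_simps)
next
  fix u v w :: "'b \<Rightarrow>\<^sub>0 complex" and c :: complex
  show "poly_mapping_cinner u (v + w) = poly_mapping_cinner u v + poly_mapping_cinner u w"
    by (simp add: poly_mapping_cinner_def lookup_add algebra_simps sum.distrib)
  show "poly_mapping_cinner u (poly_mapping_scale c v) = c * poly_mapping_cinner u v"
    by (simp add: poly_mapping_cinner_def algebra_simps sum_distrib_left)
  \<comment> \<open>The two sides sum over different supports, so both are extended to the
    union.\<close>
  show "poly_mapping_cinner v u = cnj (poly_mapping_cinner u v)"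
    by (simp add: poly_mapping_cinner_eq[of "keys u \<union> keys v"] mult.commute)
  have sq: "cnj z * z = of_real ((cmod z)\<^sup>2)" for z
    unfolding complex_norm_square by (rule mult.commute)
  have *: "poly_mapping_cinner v v = of_real (\<Sum>x\<in>keys v. (cmod (lookup v x))\<^sup>2)"
    unfolding poly_mapping_cinner_def sq by simp
  show "0 \<le> Re (poly_mapping_cinner v v)"
    unfolding * by (simp add: sum_nonneg)
  show "poly_mapping_cinner v v = 0 \<longleftrightarrow> v = 0"
    unfolding * of_real_eq_0_iff
    by (subst sum_nonneg_eq_0_iff) (auto simp: in_keys_iff intro!: poly_mapping_eqI)
qed

lemma lookup_sum_single:
  assumes "finite A"
  shows "lookup (\<Sum>x\<in>A. Poly_Mapping.single x (h x)) y = (if y \<in> A then h y else 0)"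
proof -
  have "lookup (\<Sum>x\<in>A. Poly_Mapping.single x (h x)) y = (\<Sum>x\<in>A. if x = y then h x else 0)"
    by (simp add: lookup_sum lookup_single when_def)
  then show ?thesis using assms by (simp add: sum.delta)
qed

lemma poly_mapping_cinner_sum_single:
  assumes "finite A"
  shows "poly_mapping_cinner (\<Sum>x\<in>A. Poly_Mapping.single x (g x))
           (\<Sum>x\<in>A. Poly_Mapping.single x (h x)) = (\<Sum>x\<in>A. cnj (g x) * h x)"
proof -
  have "keys (\<Sum>x\<in>A. Poly_Mapping.single x (g x)) \<subseteq> A"
    using assms by (auto simp: in_keys_iff lookup_sum_single split: if_splits)
  then show ?thesis
    using assms by (simp add: poly_mapping_cinner_eq[of A] lookup_sum_single)
qed

section \<open>Sufficiency of the three conditions\<close>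

lemma convolution_propertyD:
  assumes "group G'" "convolution_property G G' U"
    and "a \<in> carrier G" "b \<in> carrier G" "c \<in> carrier G'"
  shows "U (a \<otimes>\<^bsub>G\<^esub> b) c = (\<Sum>x\<in>carrier G'. U a x * U b (inv\<^bsub>G'\<^esub> x \<otimes>\<^bsub>G'\<^esub> c))"
  using assms group.sum_factorizations[OF assms(1,5)]
  by (simp add: convolution_property_def)

text \<open>\<open>U \<one>\<close> is a left convolution unit for all rows of \<open>U\<close>, and these span the functions on \<open>G'\<close>.\<close>

lemma unitary_convolution_one_row:
  fixes G :: "('a, 'm) monoid_scheme" and G' :: "('b, 'n) monoid_scheme"
  assumes "group G" "group G'" and fin: "finite (carrier G')"
    and unitary: "unitary_matrix (carrier G) (carrier G') U"
    and conv: "convolution_property G G' U"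
    and z: "z \<in> carrier G'"
  shows "U \<one>\<^bsub>G\<^esub> z = (if z = \<one>\<^bsub>G'\<^esub> then 1 else 0)"
proof -
  interpret G: group G by fact
  interpret H: group G' by fact
  have col: "(\<Sum>i\<in>carrier G. cnj (U i j) * U i l) = (if j = l then 1 else 0)"
    if "j \<in> carrier G'" "l \<in> carrier G'" for j l
    using unitary that by (simp add: unitary_matrix_def)
  have "(if z = \<one>\<^bsub>G'\<^esub> then 1 else 0) = (\<Sum>a\<in>carrier G. cnj (U a \<one>\<^bsub>G'\<^esub>) * U a z)"
    using z by (auto simp: col)
  \<comment> \<open>Condition (3) is applied to \<open>a\<close> written as the product of the
    identity and \<open>a\<close>; swapping the sums then exposes a product of two columns of
    \<open>U\<close>.\<close>
  also have "\<dots> = (\<Sum>a\<in>carrier G. cnj (U a \<one>\<^bsub>G'\<^esub>) *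
      (\<Sum>x\<in>carrier G'. U \<one>\<^bsub>G\<^esub> x * U a (inv\<^bsub>G'\<^esub> x \<otimes>\<^bsub>G'\<^esub> z)))"
    using convolution_propertyD[OF \<open>group G'\<close> conv G.one_closed _ z]
    by (intro sum.cong refl) simp
  also have "\<dots> = (\<Sum>x\<in>carrier G'. U \<one>\<^bsub>G\<^esub> x *
      (\<Sum>a\<in>carrier G. cnj (U a \<one>\<^bsub>G'\<^esub>) * U a (inv\<^bsub>G'\<^esub> x \<otimes>\<^bsub>G'\<^esub> z)))"
    unfolding sum_distrib_left by (subst sum.swap) (simp add: algebra_simps)
  \<comment> \<open>The inner sum is 1 exactly when \<open>inv x \<otimes> z\<close> is the
    identity, that is, when \<open>x = z\<close>.\<close>
  also have "\<dots> = (\<Sum>x\<in>carrier G'. if x = z then U \<one>\<^bsub>G\<^esub> x else 0)"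
    using z H.inv_mult_eq_one_iff
    by (intro sum.cong refl) (auto simp: col dest: sym)
  finally show ?thesis using z fin by simp
qed

lemma is_transformation_matrixI:
  fixes G :: "('a, 'm) monoid_scheme" and G' :: "('b, 'n) monoid_scheme"
  assumes "group G" "finite (carrier G)" "group G'" "finite (carrier G')"
    and unitary: "unitary_matrix (carrier G) (carrier G') U"
    and cnj: "\<forall>a\<in>carrier G. \<forall>b\<in>carrier G'. cnj (U a b) = U (inv\<^bsub>G\<^esub> a) (inv\<^bsub>G'\<^esub> b)"
    and conv: "convolution_property G G' U"
  shows "is_transformation_matrix TYPE('b \<Rightarrow>\<^sub>0 complex) G G' U"
proof -
  interpret G: group G by fact
  interpret H: group G' by fact
  interpret P: complex_inner_product_space poly_mapping_scale
      "poly_mapping_cinner :: ('b \<Rightarrow>\<^sub>0 complex) \<Rightarrow> _"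
    by (rule complex_inner_product_space_poly_mapping)
  define e :: "'b \<Rightarrow> 'b \<Rightarrow>\<^sub>0 complex" where "e x = Poly_Mapping.single x 1" for x
  \<comment> \<open>The type \<open>'b\<close> may have elements outside \<open>carrier G'\<close>,
    so \<open>V\<close> is spanned only by the unit vectors at group elements.\<close>
  define V where "V = P.span (e ` carrier G')"
  \<comment> \<open>By \<open>unitary_convolution_one_row\<close>, the row of this array at the
    identity is \<open>e\<close> itself.\<close>
  define \<Psi> where "\<Psi> a b = (\<Sum>x\<in>carrier G'. Poly_Mapping.single x (U a (inv\<^bsub>G'\<^esub> x \<otimes>\<^bsub>G'\<^esub> b)))" for a b
  have ip: "poly_mapping_cinner (\<Psi> a b) (\<Psi> c d) = U (inv\<^bsub>G\<^esub> a \<otimes>\<^bsub>G\<^esub> c) (inv\<^bsub>G'\<^esub> b \<otimes>\<^bsub>G'\<^esub> d)"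
    if "a \<in> carrier G" "c \<in> carrier G" "b \<in> carrier G'" "d \<in> carrier G'" for a b c d
  proof -
    have "U (inv\<^bsub>G\<^esub> a \<otimes>\<^bsub>G\<^esub> c) (inv\<^bsub>G'\<^esub> b \<otimes>\<^bsub>G'\<^esub> d) =
        (\<Sum>x\<in>carrier G'. U (inv\<^bsub>G\<^esub> a) x * U c (inv\<^bsub>G'\<^esub> x \<otimes>\<^bsub>G'\<^esub> (inv\<^bsub>G'\<^esub> b \<otimes>\<^bsub>G'\<^esub> d)))"
      using that by (intro convolution_propertyD[OF \<open>group G'\<close> conv]) auto
    \<comment> \<open>Shifting the summation variable by \<open>inv b\<close> makes \<open>b\<close>
      cancel in the second factor, while (2) turns the first into a conjugate; the convolution
      becomes an inner product.\<close>
    also have "\<dots> = (\<Sum>x\<in>carrier G'. U (inv\<^bsub>G\<^esub> a) (inv\<^bsub>G'\<^esub> b \<otimes>\<^bsub>G'\<^esub> x) *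
        U c (inv\<^bsub>G'\<^esub> (inv\<^bsub>G'\<^esub> b \<otimes>\<^bsub>G'\<^esub> x) \<otimes>\<^bsub>G'\<^esub> (inv\<^bsub>G'\<^esub> b \<otimes>\<^bsub>G'\<^esub> d)))"
      using that by (intro H.sum_left_mult[symmetric]) auto
    also have "\<dots> = (\<Sum>x\<in>carrier G'. cnj (U a (inv\<^bsub>G'\<^esub> x \<otimes>\<^bsub>G'\<^esub> b)) * U c (inv\<^bsub>G'\<^esub> x \<otimes>\<^bsub>G'\<^esub> d))"
    proof (intro sum.cong refl)
      fix x assume x: "x \<in> carrier G'"
      have "inv\<^bsub>G'\<^esub> (inv\<^bsub>G'\<^esub> b \<otimes>\<^bsub>G'\<^esub> x) \<otimes>\<^bsub>G'\<^esub> (inv\<^bsub>G'\<^esub> b \<otimes>\<^bsub>G'\<^esub> d) = inv\<^bsub>G'\<^esub> x \<otimes>\<^bsub>G'\<^esub> d"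
        using x that H.m_assoc[of b "inv\<^bsub>G'\<^esub> b" d] by (simp add: H.inv_mult_group H.m_assoc)
      moreover have "cnj (U a (inv\<^bsub>G'\<^esub> x \<otimes>\<^bsub>G'\<^esub> b)) = U (inv\<^bsub>G\<^esub> a) (inv\<^bsub>G'\<^esub> b \<otimes>\<^bsub>G'\<^esub> x)"
        using x that cnj by (simp add: H.inv_mult_group)
      ultimately show "U (inv\<^bsub>G\<^esub> a) (inv\<^bsub>G'\<^esub> b \<otimes>\<^bsub>G'\<^esub> x) *
          U c (inv\<^bsub>G'\<^esub> (inv\<^bsub>G'\<^esub> b \<otimes>\<^bsub>G'\<^esub> x) \<otimes>\<^bsub>G'\<^esub> (inv\<^bsub>G'\<^esub> b \<otimes>\<^bsub>G'\<^esub> d)) =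
          cnj (U a (inv\<^bsub>G'\<^esub> x \<otimes>\<^bsub>G'\<^esub> b)) * U c (inv\<^bsub>G'\<^esub> x \<otimes>\<^bsub>G'\<^esub> d)" by simp
    qed
    finally show ?thesis
      by (simp add: \<Psi>_def poly_mapping_cinner_sum_single[OF assms(4)])
  qed
  \<comment> \<open>Substituting \<open>y = inv x \<otimes> b\<close> gives the product of two rows
    of \<open>U\<close>, so unitarity applies directly and the values of \<open>U\<close> in the
    column at the identity enter only implicitly.\<close>
  have col: "P.orthonormal_family (carrier G) (\<lambda>a. \<Psi> a b)" if b: "b \<in> carrier G'" for b
    unfolding P.orthonormal_family_def
  proof (intro ballI)
    fix a c assume ac: "a \<in> carrier G" "c \<in> carrier G"
    have "poly_mapping_cinner (\<Psi> a b) (\<Psi> c b) =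
        (\<Sum>x\<in>carrier G'. cnj (U a (inv\<^bsub>G'\<^esub> x \<otimes>\<^bsub>G'\<^esub> b)) * U c (inv\<^bsub>G'\<^esub> x \<otimes>\<^bsub>G'\<^esub> b))"
      by (simp add: \<Psi>_def poly_mapping_cinner_sum_single[OF assms(4)])
    also have "\<dots> = (\<Sum>y\<in>carrier G'. cnj (U a y) * U c y)"
      by (rule H.sum_inv_mult[OF b])
    also have "\<dots> = (if a = c then 1 else 0)"
      using unitary ac by (auto simp: unitary_matrix_def mult.commute)
    finally show "poly_mapping_cinner (\<Psi> a b) (\<Psi> c b) = (if a = c then 1 else 0)" .
  qed
  \<comment> \<open>Within one row \<open>ip\<close> gives the entry of \<open>U \<one>\<close> at
    \<open>inv b \<otimes> d\<close>, which is 1 for \<open>b = d\<close> and 0 otherwise.\<close>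
  have row: "P.orthonormal_family (carrier G') (\<Psi> a)" if "a \<in> carrier G" for a
    using that unitary_convolution_one_row[OF assms(1,3,4) unitary conv]
    by (auto simp: P.orthonormal_family_def ip H.inv_mult_eq_one_iff)
  have e: "P.orthonormal_family (carrier G') e"
    by (auto simp: P.orthonormal_family_def e_def poly_mapping_cinner_def lookup_single when_def)
  have dim: "P.dim V = card (carrier G')"
    unfolding V_def
    using P.dim_span_eq_card_independent[OF P.orthonormal_family_independent[OF e]]
      P.orthonormal_family_inj_on[OF e] by (simp add: card_image)
  have card: "card (carrier G) = card (carrier G')"
    using unitary by (simp add: unitary_matrix_def)
  have inV: "\<Psi> a b \<in> V" for a b
  proof -
    have "\<Psi> a b = (\<Sum>x\<in>carrier G'. poly_mapping_scale (U a (inv\<^bsub>G'\<^esub> x \<otimes>\<^bsub>G'\<^esub> b)) (e x))"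
      unfolding \<Psi>_def e_def
      by (intro sum.cong refl poly_mapping_eqI) (simp add: lookup_single when_def)
    then show ?thesis
      by (simp add: V_def P.span_sum P.span_scale P.span_base)
  qed
  have fin: "finite (e ` carrier G')" using assms(4) by simp
  \<comment> \<open>Each row, and likewise each column, is an orthonormal family in \<open>V\<close>
    with \<open>dim V\<close> members, hence spans \<open>V\<close>; for columns this count uses
    that \<open>U\<close> is square.\<close>
  have rows: "P.orthonormal_basis V (carrier G') (\<Psi> a)" if "a \<in> carrier G" for a
    using P.orthonormal_basisI[OF row[OF that] _ _ fin V_def[symmetric]] inV dim by auto
  have cols: "P.orthonormal_basis V (carrier G) (\<lambda>a. \<Psi> a b)" if "b \<in> carrier G'" for b
    using P.orthonormal_basisI[OF col[OF that] _ _ fin V_def[symmetric]] inV dim card by auto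
  have "\<exists>B. finite B \<and> P.span B = V"
    using fin V_def by blast
  then have "P.quantum_latin_square V (carrier G) (carrier G') \<Psi>"
    using rows cols dim card assms(2,4) by (simp add: P.quantum_latin_square_def)
  then have "P.invariant_quantum_latin_square V G G' \<Psi>"
    by (simp add: P.invariant_quantum_latin_square_def ip)
  moreover have "P.transformation_matrix G G' \<Psi> U"
    by (auto simp: P.transformation_matrix_def ip)
  ultimately have "complex_inner_product_space poly_mapping_scale
        (poly_mapping_cinner :: ('b \<Rightarrow>\<^sub>0 complex) \<Rightarrow> _) \<and>
      P.invariant_quantum_latin_square V G G' \<Psi> \<and> P.transformation_matrix G G' \<Psi> U"
    using complex_inner_product_space_poly_mapping by (intro conjI)
  then show ?thesis
    unfolding is_transformation_matrix_def by - (rule exI)+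
qed

section \<open>The equivalence and the choice of the vector type\<close>

text \<open>The vector type is arbitrary here, so that the lemma serves both the forward direction
  of the equivalence and the comparison with other vector types.\<close>

lemma is_transformation_matrixD:
  fixes G :: "('a, 'm) monoid_scheme" and G' :: "('b, 'n) monoid_scheme"
  assumes "group G" "group G'" "is_transformation_matrix TYPE('v::ab_group_add) G G' U"
  shows "unitary_matrix (carrier G) (carrier G') U"
    and "\<forall>a\<in>carrier G. \<forall>b\<in>carrier G'. cnj (U a b) = U (inv\<^bsub>G\<^esub> a) (inv\<^bsub>G'\<^esub> b)"
    and "convolution_property G G' U"
proof -
  obtain scale :: "complex \<Rightarrow> 'v \<Rightarrow> 'v" and cinner V \<Psi> where
    ip: "complex_inner_product_space scale cinner"
    and \<Psi>: "complex_inner_product_space.invariant_quantum_latin_square scale cinner V G G' \<Psi>"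
      "complex_inner_product_space.transformation_matrix cinner G G' \<Psi> U"
    using assms(3) unfolding is_transformation_matrix_def by (elim exE conjE) (rule that)
  interpret complex_inner_product_space scale cinner by (fact ip)
  show "unitary_matrix (carrier G) (carrier G') U"
    and "\<forall>a\<in>carrier G. \<forall>b\<in>carrier G'. cnj (U a b) = U (inv\<^bsub>G\<^esub> a) (inv\<^bsub>G'\<^esub> b)"
    and "convolution_property G G' U"
    by (rule transformation_matrix_properties[OF assms(1,2) \<Psi>])+
qed

lemma is_transformation_matrix_iff:
  fixes G :: "('a, 'm) monoid_scheme" and G' :: "('b, 'n) monoid_scheme"
  assumes "group G" "finite (carrier G)" "group G'" "finite (carrier G')"
  shows "is_transformation_matrix TYPE('b \<Rightarrow>\<^sub>0 complex) G G' U \<longleftrightarrow>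
    unitary_matrix (carrier G) (carrier G') U \<and>
    (\<forall>a\<in>carrier G. \<forall>b\<in>carrier G'. cnj (U a b) = U (inv\<^bsub>G\<^esub> a) (inv\<^bsub>G'\<^esub> b)) \<and>
    convolution_property G G' U" (is "?L \<longleftrightarrow> ?R")
proof
  assume ?L
  from is_transformation_matrixD[OF assms(1,3) this] show ?R by (intro conjI)
next
  assume ?R
  then show ?L by (elim conjE) (rule is_transformation_matrixI[OF assms])
qed

(* Conclusion 1 is the equivalence, for vectors in the type of finitely supported functions
   'b => complex, which contains an isometric copy of each finite-dimensional complex inner
   product space that can occur.  Conclusion 2 says that spaces over any other type of vectors
   yield no further transformation matrices. *)
theorem theorem4p5:
  fixes G :: "('a, 'm) monoid_scheme" and G' :: "('b, 'n) monoid_scheme"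
    and U :: "'a \<Rightarrow> 'b \<Rightarrow> complex"
  assumes "group G" and "finite (carrier G)"
    and "group G'" and "finite (carrier G')"
  shows "(is_transformation_matrix TYPE('b \<Rightarrow>\<^sub>0 complex) G G' U \<longleftrightarrow>
            unitary_matrix (carrier G) (carrier G') U \<and>
            (\<forall>a\<in>carrier G. \<forall>b\<in>carrier G'. cnj (U a b) = U (inv\<^bsub>G\<^esub> a) (inv\<^bsub>G'\<^esub> b)) \<and>
            (\<forall>a\<in>carrier G. \<forall>b\<in>carrier G. \<forall>c\<in>carrier G'.
               U (a \<otimes>\<^bsub>G\<^esub> b) c =
               (\<Sum>(x, y)\<in>{(x, y). x \<in> carrier G' \<and> y \<in> carrier G' \<and> x \<otimes>\<^bsub>G'\<^esub> y = c}. U a x * U b y))) \<and>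
         (is_transformation_matrix TYPE('v::ab_group_add) G G' U \<longrightarrow>
            is_transformation_matrix TYPE('b \<Rightarrow>\<^sub>0 complex) G G' U)"
proof (rule conjI)
  show "is_transformation_matrix TYPE('v) G G' U \<longrightarrow>
      is_transformation_matrix TYPE('b \<Rightarrow>\<^sub>0 complex) G G' U"
  proof
    assume "is_transformation_matrix TYPE('v) G G' U"
    \<comment> \<open>The three conditions speak only of \<open>U\<close>, so they carry over from
      \<open>'v\<close> to the concrete vector type.\<close>
    from is_transformation_matrixD[OF assms(1,3) this]
    show "is_transformation_matrix TYPE('b \<Rightarrow>\<^sub>0 complex) G G' U"
      by (rule is_transformation_matrixI[OF assms])
  qed
qed (fact is_transformation_matrix_iff[OF assms, unfolded convolution_property_def])

end
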